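(* Let $\mathbb X,\mathbb Y$ be real Banach spaces, $C\subseteq\mathbb Y$ a closed convex cone with $\{0\}\neq C\neq\mathbb Y$, $K\subseteq\mathbb X$ a nonempty closed set and $f:\mathbb X\times\mathbb X\to\mathbb Y$. Let $\mathcal{SE}=\{\bar x\in K:\ f(\bar x,x)\in C\ \ \forall x\in K\}$ and $\nu(x)=\sup_{z\in K}\mathrm{dist}(f(x,z),C)\in[0,+\infty]$. Suppose that: (i) for every $z\in K$ the function $x\mapsto f(x,z)$ is $C$-u.s.c. on $K$; (ii) there exists $x_0\in K$ such that $f(x_0,K)=\{f(x_0,z):z\in K\}$ is $C$-bounded; (iii) $|\nabla_K f|^{>}>0$. Then $\mathcal{SE}$ is nonempty and closed, and $$\mathrm{dist}(x,\mathcal{SE})\le\frac{\nu(x)}{|\nabla_K f|^{>}},\qquad\forall x\in K.$$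
   Context: A mapping $g:\mathbb X\to\mathbb Y$ is $C$-u.s.c. at $x_0$ if for every neighbourhood $V$ of $g(x_0)$ there is a neighbourhood $U$ of $x_0$ in $\mathbb X$ with $g(x)\in V-C$ for all $x\in U$; it is $C$-u.s.c. on a set if it is so at each point of the set. A set $S\subseteq\mathbb Y$ is $C$-bounded if there is $m\ge0$ with $S\setminus C\subseteq m\mathbb B$, where $\mathbb B$ is the closed unit ball. $\mathrm{dist}(x,S)=\inf_{s\in S}\|x-s\|$, with $\mathrm{dist}(x,\varnothing)=+\infty$. For $\varphi:\mathbb X\to\mathbb R\cup\{\pm\infty\}$, a closed set $K\subseteq\mathbb X$ and $x\in K$ with $\varphi(x)\in\mathbb R$, the slope of $\varphi$ at $x$ restricted to $K$ is $|\nabla_K\varphi|(x)=0$ if $x$ is a local minimizer of $\varphi$ on $K$, and $|\nabla_K\varphi|(x)=\limsup_{u\to x,\,u\in K}\frac{\varphi(x)-\varphi(u)}{\|x-u\|}$ otherwise. Define $|\nabla_K f|^{>}=\inf\{|\nabla_K\nu|(x):\ x\in K,\ \nu(x)>0\}$, where the infimum is over those points at which the slope is defined (i.e. $0<\nu(x)<+\infty$) and $\inf\varnothing=+\infty$. Convention for the quotient: it equals $+\infty$ if $\nu(x)=+\infty$, and $0$ if $\nu(x)<+\infty$ and the denominator is $+\infty$. *)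

theory Defs
  imports "HOL-Analysis.Analysis"
begin

definition cone_usc_at ::
  "'b::real_normed_vector set \<Rightarrow> ('a::topological_space \<Rightarrow> 'b) \<Rightarrow> 'a \<Rightarrow> bool" where
  "cone_usc_at C g x0 \<longleftrightarrow>
    (\<forall>V. open V \<and> g x0 \<in> V \<longrightarrow>
      (\<exists>U. open U \<and> x0 \<in> U \<and> (\<forall>x\<in>U. g x \<in> {v - c | v c. v \<in> V \<and> c \<in> C})))"

text \<open>The neighbourhoods above are taken in the whole space, also when the
  property is required only at the points of a subset.\<close>

definition cone_usc_on ::
  "'b::real_normed_vector set \<Rightarrow> 'a::topological_space set \<Rightarrow> ('a \<Rightarrow> 'b) \<Rightarrow> bool" where
  "cone_usc_on C S g \<longleftrightarrow> (\<forall>x\<in>S. cone_usc_at C g x)"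

definition cone_bounded ::
  "'b::real_normed_vector set \<Rightarrow> 'b set \<Rightarrow> bool" where
  "cone_bounded C S \<longleftrightarrow> (\<exists>m\<ge>0. S - C \<subseteq> cball 0 m)"

text \<open>Unlike \<open>infdist\<close>, which is \<open>0\<close> on the empty set, this distance takes the
  value \<open>\<infinity>\<close> there.\<close>

definition edist_set :: "'a::real_normed_vector \<Rightarrow> 'a set \<Rightarrow> ereal" where
  "edist_set x S = (INF s\<in>S. ereal (norm (x - s)))"

text \<open>The filter \<open>at x within K\<close> excludes \<open>x\<close> itself. The slope is
  meaningful only for \<open>x \<in> K\<close> with \<open>\<phi> x\<close> finite.\<close>

definition local_minimizer_on ::
  "'a::topological_space set \<Rightarrow> ('a \<Rightarrow> ereal) \<Rightarrow> 'a \<Rightarrow> bool" where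
  "local_minimizer_on K \<phi> x \<longleftrightarrow> x \<in> K \<and> (\<forall>\<^sub>F u in at x within K. \<phi> x \<le> \<phi> u)"

definition restricted_slope ::
  "'a::real_normed_vector set \<Rightarrow> ('a \<Rightarrow> ereal) \<Rightarrow> 'a \<Rightarrow> ereal" where
  "restricted_slope K \<phi> x =
    (if local_minimizer_on K \<phi> x then 0
     else Limsup (at x within K) (\<lambda>u. (\<phi> x - \<phi> u) / ereal (norm (x - u))))"

definition strong_equilibria ::
  "'b::real_normed_vector set \<Rightarrow> 'a set \<Rightarrow> ('a \<Rightarrow> 'a \<Rightarrow> 'b) \<Rightarrow> 'a set" where
  "strong_equilibria C K f = {xb \<in> K. \<forall>x\<in>K. f xb x \<in> C}"

definition merit ::
  "'b::real_normed_vector set \<Rightarrow> 'a set \<Rightarrow> ('a \<Rightarrow> 'a \<Rightarrow> 'b) \<Rightarrow> 'a \<Rightarrow> ereal" where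
  "merit C K f x = (SUP z\<in>K. edist_set (f x z) C)"

definition slope_constant ::
  "'b::real_normed_vector set \<Rightarrow> 'a::real_normed_vector set \<Rightarrow> ('a \<Rightarrow> 'a \<Rightarrow> 'b) \<Rightarrow> ereal" where
  "slope_constant C K f =
    (INF x\<in>{x \<in> K. 0 < merit C K f x \<and> merit C K f x < \<infinity>}.
       restricted_slope K (merit C K f) x)"

text \<open>In \<open>ereal\<close> one has \<open>\<infinity> / \<infinity> = 0\<close>, whereas the error bound is void
  (right-hand side \<open>\<infinity>\<close>) wherever the numerator is infinite. A finite value
  divided by \<open>\<infinity>\<close> is \<open>0\<close> in \<open>ereal\<close>, as wanted.\<close>

definition error_quotient :: "ereal \<Rightarrow> ereal \<Rightarrow> ereal" where
  "error_quotient a b = (if a = \<infinity> then \<infinity> else a / b)"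

end

theory Submission
  imports Defs
begin

text \<open>The merit function \<open>\<nu>\<close> is lower semicontinuous on \<open>K\<close>, because subtracting an element of
  \<open>C\<close> never decreases the distance to \<open>C\<close>. Fix \<open>0 < \<sigma> < |\<nabla>\<^sub>K f|\<^sup>>\<close> and \<open>x \<in> K\<close> with \<open>\<nu> x\<close> finite.
  Ekeland's principle gives \<open>z \<in> K\<close> with \<open>\<nu> z + \<sigma> \<parallel>z - x\<parallel> \<le> \<nu> x\<close> at which all the difference
  quotients of \<open>\<nu>\<close> are below \<open>\<sigma>\<close>. Its slope is then at most \<open>\<sigma>\<close>, so \<open>\<nu> z = 0\<close>, that is, \<open>z\<close> is a
  strong equilibrium, and \<open>\<parallel>z - x\<parallel> \<le> \<nu> x / \<sigma>\<close>. Finally \<open>\<sigma>\<close> tends to the slope constant.\<close>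

section \<open>Ekeland's variational principle\<close>

lemma ekeland_variational_principle:
  fixes g :: "'a::metric_space \<Rightarrow> real"
  assumes S: "complete S" and lsc: "\<And>a. closed {u \<in> S. g u \<le> a}"
    and bdd: "\<And>u. u \<in> S \<Longrightarrow> b \<le> g u" and \<sigma>: "\<sigma> > 0" and x: "x \<in> S"
  obtains z where "z \<in> S" "g z + \<sigma> * dist z x \<le> g x"
    "\<And>u. u \<in> S \<Longrightarrow> u \<noteq> z \<Longrightarrow> g z < g u + \<sigma> * dist u z"
proof -
  \<comment> \<open>\<open>u \<in> T y\<close> says that \<open>g\<close> descends from
    \<open>y\<close> to \<open>u\<close> at rate at least \<open>\<sigma>\<close>. This relation is
    reflexive and transitive, and the desired \<open>z\<close> is a point with
    \<open>T z = {z}\<close>.\<close>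
  define T where "T y = {u \<in> S. g u + \<sigma> * dist u y \<le> g y}" for y
  have T_trans: "w \<in> T y" if "w \<in> T u" "u \<in> T y" for w u y
  proof -
    have "\<sigma> * dist w y \<le> \<sigma> * dist w u + \<sigma> * dist u y"
      using \<sigma> by (metis dist_triangle distrib_left mult_left_mono less_imp_le)
    with that show ?thesis by (auto simp: T_def)
  qed
  have T_refl: "y \<in> T y" if "y \<in> S" for y using that by (simp add: T_def)
  have near_min: "\<exists>y'. y' \<in> S \<and> y' \<in> T y \<and> (\<forall>u\<in>T y. g y' \<le> g u + \<epsilon>)"
    if y: "y \<in> S" "\<epsilon> > 0" for y \<epsilon>
  proof -
    have bb: "bdd_below (g ` T y)" using bdd by (auto simp: T_def intro!: bdd_belowI)
    have ne: "g ` T y \<noteq> {}" using T_refl y by blast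
    obtain y' where y': "y' \<in> T y" "g y' < Inf (g ` T y) + \<epsilon>"
      using cInf_lessD[OF ne, of "Inf (g ` T y) + \<epsilon>"] y by auto
    moreover have "Inf (g ` T y) \<le> g u" if "u \<in> T y" for u
      using that by (intro cInf_lower bb) auto
    ultimately show ?thesis by (fastforce simp: T_def)
  qed
  \<comment> \<open>Each new point almost minimizes \<open>g\<close> over the current set
    \<open>T (Y n)\<close>; the errors tend to zero, which makes these sets shrink to a
    point.\<close>
  have "\<exists>Y. \<forall>n. (Y n \<in> S \<and> (n = 0 \<longrightarrow> Y n = x)) \<and>
      (Y (Suc n) \<in> T (Y n) \<and> (\<forall>u\<in>T (Y n). g (Y (Suc n)) \<le> g u + 1 / real (Suc n)))"
    by (rule dependent_nat_choice) (use x near_min in auto)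
  then obtain Y where YS: "\<And>n. Y n \<in> S" and Y0: "Y 0 = x"
    and Y1: "\<And>n. Y (Suc n) \<in> T (Y n)"
    and Y2: "\<And>n u. u \<in> T (Y n) \<Longrightarrow> g (Y (Suc n)) \<le> g u + 1 / real (Suc n)"
    by blast
  have mono: "Y m \<in> T (Y n)" if "n \<le> m" for n m
    using that by (induction m rule: dec_induct) (use T_refl YS Y1 T_trans in blast)+
  \<comment> \<open>Such a \<open>u\<close> also lies in \<open>T (Y n)\<close>, where
    \<open>g\<close> can drop below \<open>g (Y (Suc n))\<close> by at most
    \<open>1 / Suc n\<close>. Descent at rate \<open>\<sigma>\<close> then limits the
    distance.\<close>
  have small: "dist u (Y (Suc n)) \<le> (1 / \<sigma>) * inverse (real (Suc n))" if "u \<in> T (Y (Suc n))" for u n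
  proof -
    have "u \<in> T (Y n)" using that Y1 T_trans by blast
    then have "\<sigma> * dist u (Y (Suc n)) \<le> 1 / real (Suc n)"
      using Y2[of u n] that by (auto simp: T_def)
    then have "dist u (Y (Suc n)) \<le> 1 / real (Suc n) / \<sigma>"
      using \<sigma> by (simp add: pos_le_divide_eq mult_ac del: of_nat_Suc)
    then show ?thesis by (simp add: divide_inverse mult.commute)
  qed
  have lim0: "(\<lambda>n. (1 / \<sigma>) * inverse (real (Suc n))) \<longlonglongrightarrow> 0"
    by (rule tendsto_mult_right_zero[OF LIMSEQ_inverse_real_of_nat])
  have "Cauchy Y"
  proof (rule metric_CauchyI)
    fix e :: real assume "e > 0"
    then obtain n where n: "(1 / \<sigma>) * inverse (real (Suc n)) < e / 2"
      using order_tendstoD(2)[OF lim0, of "e / 2"] by (auto simp: eventually_sequentially)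
    have "dist (Y i) (Y j) < e" if "i \<ge> Suc n" "j \<ge> Suc n" for i j
      using small[OF mono[OF that(1)]] small[OF mono[OF that(2)]] n
        dist_triangle2[of "Y i" "Y j" "Y (Suc n)"] by linarith
    then show "\<exists>M. \<forall>m\<ge>M. \<forall>n\<ge>M. dist (Y m) (Y n) < e" by blast
  qed
  with S YS obtain z where z: "z \<in> S" "Y \<longlonglongrightarrow> z"
    unfolding complete_def by blast
  have gz: "g z \<le> g (Y n)" for n
  proof -
    have "g (Y m) \<le> g (Y n)" if "n \<le> m" for m
      using mono[OF that] \<sigma> by (simp add: T_def) (smt (verit) mult_nonneg_nonneg zero_le_dist)
    then have "eventually (\<lambda>m. Y m \<in> {u \<in> S. g u \<le> g (Y n)}) sequentially"
      using YS by (auto simp: eventually_sequentially)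
    from Lim_in_closed_set[OF lsc this _ z(2)] show ?thesis by simp
  qed
  have zT: "z \<in> T (Y n)" for n
  proof -
    have "(\<lambda>m. g z + \<sigma> * dist (Y m) (Y n)) \<longlonglongrightarrow> g z + \<sigma> * dist z (Y n)"
      by (intro tendsto_intros z)
    moreover have "g z + \<sigma> * dist (Y m) (Y n) \<le> g (Y n)" if "n \<le> m" for m
      using mono[OF that] gz[of m] by (simp add: T_def)
    ultimately have "g z + \<sigma> * dist z (Y n) \<le> g (Y n)"
      by (intro LIMSEQ_le_const2) auto
    with z show ?thesis by (simp add: T_def)
  qed
  \<comment> \<open>By transitivity \<open>T z\<close> lies in every \<open>T (Y n)\<close>, and
    \<open>small\<close> forces any \<open>u\<close> in it to be the limit of \<open>Y\<close> as
    well.\<close>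
  have "u = z" if "u \<in> T z" for u
  proof -
    have "(\<lambda>n. dist u (Y (Suc n))) \<longlonglongrightarrow> 0"
      by (rule tendsto_sandwich[OF _ _ tendsto_const lim0])
        (use small T_trans[OF that zT] in \<open>auto intro!: always_eventually\<close>)
    moreover have "(\<lambda>n. dist u (Y (Suc n))) \<longlonglongrightarrow> dist u z"
      by (intro tendsto_intros LIMSEQ_Suc z)
    ultimately show ?thesis using LIMSEQ_unique by fastforce
  qed
  then show ?thesis
    using that[of z] z zT[of 0] Y0 by (force simp: T_def)
qed

section \<open>Distance to the cone and lower semicontinuity of the merit function\<close>

lemma edist_set_eq_infdist:
  assumes "S \<noteq> {}"
  shows "edist_set x S = ereal (infdist x S)"
proof (rule antisym)
  show "ereal (infdist x S) \<le> edist_set x S"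
    unfolding edist_set_def
    by (rule INF_greatest) (auto simp: dist_norm[symmetric] intro: infdist_le)
  show "edist_set x S \<le> ereal (infdist x S)"
  proof (rule ereal_le_epsilon2)
    fix e :: real assume "e > 0"
    have "Inf (dist x ` S) < infdist x S + e"
      using \<open>e > 0\<close> assms by (simp add: infdist_def)
    then obtain s where "s \<in> S" "dist x s < infdist x S + e"
      using cInf_lessD[of "dist x ` S"] assms by auto
    then show "edist_set x S \<le> ereal (infdist x S) + ereal e"
      unfolding edist_set_def by (intro INF_lower2[of s]) (auto simp: dist_norm)
  qed
qed

text \<open>Since \<open>(v - c) - c' = v - (c + c')\<close> and \<open>c + c' \<in> C\<close>,
  every distance from \<open>v - c\<close> to a point of \<open>C\<close> is also a distance from
  \<open>v\<close> to a point of \<open>C\<close>.\<close>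

lemma infdist_le_infdist_diff:
  fixes C :: "'b::real_normed_vector set"
  assumes "convex_cone C" "c \<in> C"
  shows "infdist v C \<le> infdist (v - c) C"
proof -
  have ne: "C \<noteq> {}" using assms(2) by auto
  have "infdist v C \<le> dist (v - c) c'" if "c' \<in> C" for c'
  proof -
    have "c + c' \<in> C" using assms that convex_cone_add by blast
    from infdist_le[OF this, of v] show ?thesis by (simp only: dist_norm diff_diff_eq)
  qed
  then show ?thesis
    unfolding infdist_notempty[OF ne, of "v - c"] by (intro cINF_greatest ne)
qed

text \<open>The open set \<open>V = {y. r < infdist y C}\<close> is stable under subtracting
  elements of \<open>C\<close>, so upper semicontinuity at a point of \<open>K\<close> with value in
  \<open>V\<close> keeps all nearby values in \<open>V\<close>.\<close>

lemma closed_infdist_sublevel: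
  fixes K :: "'a::topological_space set"
  assumes "convex_cone C" "closed K" "cone_usc_on C K g"
  shows "closed {u \<in> K. infdist (g u) C \<le> r}"
  unfolding closed_def
proof (subst open_subopen, intro ballI)
  fix x assume x: "x \<in> - {u \<in> K. infdist (g u) C \<le> r}"
  show "\<exists>U. open U \<and> x \<in> U \<and> U \<subseteq> - {u \<in> K. infdist (g u) C \<le> r}"
  proof (cases "x \<in> K")
    case False
    then show ?thesis using \<open>closed K\<close> by (intro exI[of _ "- K"]) auto
  next
    case True
    let ?V = "{y. r < infdist y C}"
    have "open ?V" by (intro open_Collect_less continuous_intros)
    moreover have "g x \<in> ?V" using x True by auto
    ultimately obtain U where U: "open U" "x \<in> U"
      "\<And>u. u \<in> U \<Longrightarrow> g u \<in> {v - c | v c. v \<in> ?V \<and> c \<in> C}"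
      using assms(3) True unfolding cone_usc_on_def cone_usc_at_def by meson
    have "r < infdist (g u) C" if u: "u \<in> U" for u
    proof -
      obtain v c where "g u = v - c" "r < infdist v C" "c \<in> C" using U(3)[OF u] by blast
      then show ?thesis using infdist_le_infdist_diff[OF assms(1), of c v] by simp
    qed
    then show ?thesis using U by (intro exI[of _ U]) force
  qed
qed

lemma merit_le_iff:
  assumes "C \<noteq> {}"
  shows "merit C K f x \<le> ereal r \<longleftrightarrow> (\<forall>z\<in>K. infdist (f x z) C \<le> r)"
  by (simp add: merit_def SUP_le_iff edist_set_eq_infdist[OF assms])

lemma merit_nonneg:
  assumes "C \<noteq> {}" "K \<noteq> {}"
  shows "0 \<le> merit C K f x"
proof -
  obtain z where "z \<in> K" using assms(2) by blast
  then show ?thesis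
    unfolding merit_def edist_set_eq_infdist[OF assms(1)]
    by (intro SUP_upper2[of z]) (auto intro: infdist_nonneg)
qed

text \<open>A sublevel set of a supremum is the intersection of the sublevel sets;
  \<open>K \<noteq> {}\<close> keeps this intersection inside \<open>K\<close>.\<close>

lemma closed_merit_sublevel:
  assumes "convex_cone C" "closed K" "K \<noteq> {}"
    and "\<And>z. z \<in> K \<Longrightarrow> cone_usc_on C K (\<lambda>x. f x z)"
  shows "closed {u \<in> K. merit C K f u \<le> ereal r}"
proof -
  have "C \<noteq> {}" using assms(1) by (rule convex_cone_nonempty)
  then have "{u \<in> K. merit C K f u \<le> ereal r} = (\<Inter>z\<in>K. {u \<in> K. infdist (f u z) C \<le> r})"
    using \<open>K \<noteq> {}\<close> by (auto simp: merit_le_iff)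
  then show ?thesis using assms by (auto intro!: closed_INT closed_infdist_sublevel)
qed

lemma strong_equilibria_eq_merit_sublevel:
  assumes "closed C" "C \<noteq> {}"
  shows "strong_equilibria C K f = {x \<in> K. merit C K f x \<le> 0}"
proof -
  have "f x z \<in> C \<longleftrightarrow> infdist (f x z) C \<le> 0" for x z
    using in_closed_iff_infdist_zero[OF assms] infdist_nonneg[of "f x z" C] by force
  then show ?thesis
    using merit_le_iff[OF assms(2), of K f _ 0] by (auto simp: strong_equilibria_def zero_ereal_def)
qed

text \<open>As \<open>0 \<in> C\<close>, the distance to \<open>C\<close> is at most the norm, which
  is bounded by \<open>m\<close> for values outside \<open>C\<close>.\<close>

lemma merit_finite_of_cone_bounded:
  assumes "convex_cone C" "cone_bounded C (f x ` K)"
  shows "merit C K f x < \<infinity>"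
proof -
  have ne: "C \<noteq> {}" and C0: "0 \<in> C"
    using assms(1) by (simp_all add: convex_cone_nonempty convex_cone_contains_0)
  obtain m where m: "m \<ge> 0" "f x ` K - C \<subseteq> cball 0 m"
    using assms(2) by (auto simp: cone_bounded_def)
  have "infdist (f x z) C \<le> m" if "z \<in> K" for z
  proof (cases "f x z \<in> C")
    case True
    then show ?thesis using m by simp
  next
    case False
    then have "f x z \<in> cball 0 m" using m that by blast
    then show ?thesis using infdist_le[OF C0, of "f x z"] by simp
  qed
  then have "merit C K f x \<le> ereal m" by (simp add: merit_le_iff[OF ne])
  then show ?thesis by (auto simp: less_top[symmetric] top_ereal_def)
qed

section \<open>From slopes to the error bound\<close>

lemma restricted_slope_le:
  assumes "\<phi> x = ereal r" "0 \<le> \<sigma>"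
    and le: "\<And>u. u \<in> K \<Longrightarrow> u \<noteq> x \<Longrightarrow> \<phi> x \<le> \<phi> u + ereal (\<sigma> * norm (x - u))"
  shows "restricted_slope K \<phi> x \<le> ereal \<sigma>"
proof -
  \<comment> \<open>If \<open>\<phi> u = \<infinity>\<close>, the quotient is
    \<open>-\<infinity>\<close>; the value \<open>-\<infinity>\<close> of \<open>\<phi> u\<close> is
    excluded by \<open>le\<close>, because \<open>\<phi> x\<close> is finite.\<close>
  have "(\<phi> x - \<phi> u) / ereal (norm (x - u)) \<le> ereal \<sigma>" if "u \<in> K" "u \<noteq> x" for u
    using le[OF that] that(2) assms(1)
    by (cases "\<phi> u") (auto simp: field_simps)
  then have "Limsup (at x within K) (\<lambda>u. (\<phi> x - \<phi> u) / ereal (norm (x - u))) \<le> ereal \<sigma>"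
    by (intro Limsup_bounded) (auto simp: eventually_at_filter)
  then show ?thesis using assms(2) by (simp add: restricted_slope_def)
qed

text \<open>Ekeland's principle is applied on the sublevel set of \<open>x\<close>, which is
  complete and on which \<open>\<phi>\<close> is real-valued.\<close>

lemma exists_zero_of_slope_bound:
  fixes K :: "'a::banach set"
  assumes K: "closed K" and lsc: "\<And>r. closed {u \<in> K. \<phi> u \<le> ereal r}"
    and nonneg: "\<And>u. 0 \<le> \<phi> u" and \<sigma>: "0 < \<sigma>"
    and slope: "\<And>u. u \<in> K \<Longrightarrow> 0 < \<phi> u \<Longrightarrow> \<phi> u < \<infinity> \<Longrightarrow> ereal \<sigma> < restricted_slope K \<phi> u"
    and x: "x \<in> K" "\<phi> x = ereal r"
  obtains z where "z \<in> K" "\<phi> z = 0" "\<sigma> * norm (x - z) \<le> r"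
proof -
  define S where "S = {u \<in> K. \<phi> u \<le> ereal r}"
  \<comment> \<open>\<open>real_of_ereal\<close> sends \<open>\<infinity>\<close> to
    \<open>0\<close>, so \<open>g\<close> represents \<open>\<phi>\<close> only where the latter is
    finite, in particular on \<open>S\<close>.\<close>
  define g where "g u = real_of_ereal (\<phi> u)" for u
  have fin: "\<phi> u = ereal (g u)" if "u \<in> S" for u
    using that nonneg[of u] by (cases "\<phi> u") (auto simp: S_def g_def)
  have "closed {u \<in> S. g u \<le> a}" for a
  proof -
    have "{u \<in> S. g u \<le> a} = S \<inter> {u \<in> K. \<phi> u \<le> ereal a}"
      using fin by (fastforce simp: S_def)
    then show ?thesis using lsc by (auto simp: S_def intro!: closed_Int)
  qed
  moreover have "complete S" using lsc by (simp add: S_def complete_eq_closed)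
  moreover have "0 \<le> g u" for u using nonneg[of u] by (simp add: g_def real_of_ereal_pos)
  moreover have xS: "x \<in> S" using x by (simp add: S_def)
  ultimately obtain z where z: "z \<in> S" "g z + \<sigma> * dist z x \<le> g x"
    "\<And>u. u \<in> S \<Longrightarrow> u \<noteq> z \<Longrightarrow> g z < g u + \<sigma> * dist u z"
    using ekeland_variational_principle[of S g 0 \<sigma> x] \<sigma> by metis
  have zK: "z \<in> K" using z by (simp add: S_def)
  \<comment> \<open>The slope at \<open>z\<close> involves all of \<open>K\<close>, while Ekeland
    compares only within \<open>S\<close>. Points of \<open>K\<close> outside \<open>S\<close> have
    values above \<open>r\<close>, hence above \<open>\<phi> z\<close>.\<close>
  have "\<phi> z \<le> \<phi> u + ereal (\<sigma> * norm (z - u))" if "u \<in> K" "u \<noteq> z" for u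
  proof (cases "u \<in> S")
    case True
    then show ?thesis
      using z(3)[OF True that(2)] fin[OF True] fin[OF z(1)] by (simp add: dist_norm norm_minus_commute)
  next
    case False
    then have "\<phi> z \<le> \<phi> u" using that z(1) by (auto simp: S_def)
    also have "\<phi> u \<le> \<phi> u + ereal (\<sigma> * norm (z - u))"
      using \<sigma> by (cases "\<phi> u") auto
    finally show ?thesis .
  qed
  then have "restricted_slope K \<phi> z \<le> ereal \<sigma>"
    using restricted_slope_le[of \<phi> z "g z" \<sigma> K] fin[OF z(1)] \<sigma> by simp
  then have "\<phi> z = 0"
    using slope[OF zK] fin[OF z(1)] nonneg[of z] by (force simp: less_le)
  moreover have "\<sigma> * norm (x - z) \<le> r"
    using z(2) x(2) \<open>\<phi> z = 0\<close> by (simp add: g_def dist_norm norm_minus_commute)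
  ultimately show ?thesis using that zK by blast
qed

text \<open>Carries out the limit of \<open>\<sigma>\<close> towards \<open>c\<close> from below,
  separately for finite and infinite \<open>c\<close>.\<close>

lemma ereal_le_divide_of_real_below:
  fixes c e :: ereal
  assumes "0 < c" "0 \<le> e"
    and le: "\<And>\<sigma>. 0 < \<sigma> \<Longrightarrow> ereal \<sigma> < c \<Longrightarrow> e \<le> ereal (r / \<sigma>)"
  shows "e \<le> ereal r / c"
proof -
  \<comment> \<open>A single admissible \<open>\<sigma>\<close> already shows that \<open>e\<close>
    is finite.\<close>
  obtain \<sigma>0 where "0 < \<sigma>0" "ereal \<sigma>0 < c"
    using ereal_dense2[OF assms(1)] by auto
  then have "e \<noteq> \<infinity>" using le by force
  then obtain d where d: "e = ereal d" "d \<ge> 0" using assms(2) by (cases e) auto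
  show ?thesis
  proof (cases c)
    case (real c')
    have "d * c' \<le> r"
    proof (rule ccontr)
      assume "\<not> d * c' \<le> r"
      moreover have "((\<lambda>\<sigma>. d * \<sigma>) \<longlongrightarrow> d * c') (at_left c')" by (intro tendsto_intros)
      ultimately have "\<forall>\<^sub>F \<sigma> in at_left c'. r < d * \<sigma>"
        by (intro order_tendstoD(1)[of _ "d * c'"]) auto
      moreover have "\<forall>\<^sub>F \<sigma> in at_left c'. \<sigma> \<in> {0<..<c'}"
        using real assms(1) by (intro eventually_at_leftI[of 0]) auto
      ultimately have "\<forall>\<^sub>F \<sigma> in at_left c'. r < d * \<sigma> \<and> 0 < \<sigma> \<and> \<sigma> < c'"
        by eventually_elim auto
      then obtain \<sigma> where "r < d * \<sigma>" "0 < \<sigma>" "\<sigma> < c'"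
        using eventually_happens trivial_limit_at_left_real by blast
      then show False using le[of \<sigma>] d real by (simp add: pos_le_divide_eq)
    qed
    then show ?thesis using d real assms(1) by (simp add: pos_le_divide_eq)
  next
    case PInf
    \<comment> \<open>Every positive \<open>\<sigma>\<close> is admissible now, and
      \<open>r / \<sigma>\<close> tends to \<open>0\<close>, the value of
      \<open>ereal r / \<infinity>\<close>.\<close>
    have "d \<le> 0"
    proof (rule tendsto_lowerbound)
      show "((\<lambda>\<sigma>. r / \<sigma>) \<longlongrightarrow> 0) at_top"
        by (intro tendsto_divide_0[OF tendsto_const] filterlim_at_top_imp_at_infinity filterlim_ident)
      show "\<forall>\<^sub>F \<sigma> in at_top. d \<le> r / \<sigma>"
        using eventually_gt_at_top[of 0] by eventually_elim (use le d PInf in auto)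
    qed simp
    then show ?thesis using d PInf by simp
  qed (use assms in auto)
qed

theorem theorem3p2:
  fixes C :: "'b::banach set"
    and K :: "'a::banach set"
    and f :: "'a \<Rightarrow> 'a \<Rightarrow> 'b"
  assumes "closed C" and "convex_cone C" and "C \<noteq> {0}" and "C \<noteq> UNIV"
    and "K \<noteq> {}" and "closed K"
    and "\<And>z. z \<in> K \<Longrightarrow> cone_usc_on C K (\<lambda>x. f x z)"
    and "\<exists>x0\<in>K. cone_bounded C (f x0 ` K)"
    and "slope_constant C K f > 0"
  shows "strong_equilibria C K f \<noteq> {} \<and>
    closed (strong_equilibria C K f) \<and>
    (\<forall>x\<in>K. edist_set x (strong_equilibria C K f)
       \<le> error_quotient (merit C K f x) (slope_constant C K f))"
proof -
  let ?\<nu> = "merit C K f"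
  let ?E = "strong_equilibria C K f"
  let ?c = "slope_constant C K f"
  have ne: "C \<noteq> {}" using assms(2) by (rule convex_cone_nonempty)
  note SE = strong_equilibria_eq_merit_sublevel[OF assms(1) ne, of K f]
  note lsc = closed_merit_sublevel[where f = f, OF assms(2,6,5,7)]
  note nonneg = merit_nonneg[OF ne assms(5), of f]
  have near: "\<exists>z\<in>?E. \<sigma> * norm (x - z) \<le> r"
    if x: "x \<in> K" "?\<nu> x = ereal r" and \<sigma>: "0 < \<sigma>" "ereal \<sigma> < ?c" for x r \<sigma>
  proof -
    have slope: "ereal \<sigma> < restricted_slope K ?\<nu> u"
      if "u \<in> K" "0 < ?\<nu> u" "?\<nu> u < \<infinity>" for u
    proof -
      have "?c \<le> restricted_slope K ?\<nu> u"
        unfolding slope_constant_def by (rule INF_lower) (use that in simp)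
      with \<sigma>(2) show ?thesis by (rule less_le_trans)
    qed
    obtain z where "z \<in> K" "?\<nu> z = 0" "\<sigma> * norm (x - z) \<le> r"
      by (rule exists_zero_of_slope_bound[where \<phi> = ?\<nu>, OF assms(6) lsc nonneg \<sigma>(1) slope x])
    then show ?thesis using SE by auto
  qed
  \<comment> \<open>The finite merit at \<open>x0\<close> provides a starting point for the descent,
    whence an equilibrium exists.\<close>
  obtain x0 where x0: "x0 \<in> K" "cone_bounded C (f x0 ` K)"
    using assms(8) by (rule bexE)
  then obtain r0 where "?\<nu> x0 = ereal r0"
    using merit_finite_of_cone_bounded[of C f x0 K, OF assms(2) x0(2)] nonneg[of x0]
    by (cases "?\<nu> x0") auto
  moreover obtain \<sigma>0 where "0 < \<sigma>0" "ereal \<sigma>0 < ?c"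
    using ereal_dense2[OF assms(9)] by auto
  ultimately have "?E \<noteq> {}" using near[OF x0(1)] by blast
  moreover have "closed ?E" using lsc[of 0] SE by (simp add: zero_ereal_def)
  moreover have "edist_set x ?E \<le> error_quotient (?\<nu> x) ?c" if x: "x \<in> K" for x
  proof (cases "?\<nu> x = \<infinity>")
    case True
    then show ?thesis by (simp add: error_quotient_def)
  next
    case False
    then obtain r where r: "?\<nu> x = ereal r" using nonneg[of x] by (cases "?\<nu> x") auto
    have "edist_set x ?E \<le> ereal (r / \<sigma>)" if \<sigma>: "0 < \<sigma>" "ereal \<sigma> < ?c" for \<sigma>
    proof -
      obtain z where "z \<in> ?E" "\<sigma> * norm (x - z) \<le> r" using near[OF x r \<sigma>] by blast
      then show ?thesis
        unfolding edist_set_def using \<sigma>(1)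
        by (intro INF_lower2[of z]) (simp_all add: pos_le_divide_eq mult.commute)
    qed
    moreover have "0 \<le> edist_set x ?E"
      unfolding edist_set_def by (rule INF_greatest) simp
    ultimately show ?thesis
      using ereal_le_divide_of_real_below[OF assms(9)] r by (simp add: error_quotient_def)
  qed
  ultimately show ?thesis by blast
qed

end
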